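(* Let $x,y$ be two independent indeterminates. For every integer partition $\lambda$, let $X$ be the (finite) alphabet $X=\left\{b-1-(a-1)/\alpha\right\}_{(a,b)\in\lambda}$, with one element for each cell $(a,b)$ of the Ferrers diagram of $\lambda$ (values counted with multiplicity). Then $$\frac{(y-x)_\lambda}{(y)_\lambda}=\sum_{i=0}^{|\lambda|}\ \sum_{j=0}^{+\infty}(-1)^{i+j}\,\frac{x^i}{y^{i+j}}\sum_{k=0}^{\min(i,j)}\binom{|\lambda|-j}{i-k}\sum_{\mu\vdash j}\frac{\left\langle{\mu\atop k}\right\rangle}{z_\mu}\,p_\mu(X),$$ as an identity of formal power series in $1/y$ with coefficients polynomial in $x$.
   Context: A partition $\lambda$ is identified with its Ferrers diagram, the set of cells $(a,b)$ with $1\le a\le l(\lambda)$ (row) and $1\le b\le\lambda_a$ (column). With a parameter $\alpha$ (an indeterminate), $(x)_\lambda=\prod_{(a,b)\in\lambda}\left(x+b-1-(a-1)/\alpha\right)$. For a partition $\mu$: $|\mu|$ is the sum of its parts, $\mu\vdash j$ means $|\mu|=j$, $l(\mu)$ is the number of (nonzero) parts, $m_i(\mu)$ is the number of parts equal to $i\ge1$, and $z_\mu=\prod_{i\ge1}i^{m_i(\mu)}m_i(\mu)!$. The generalized binomial coefficient $\left\langle{\mu\atop k}\right\rangle$ (for an integer $k\ge0$) is the number of ways to choose $k$ cells in the Ferrers diagram of $\mu$ with at least one cell chosen in each row (so for the empty partition it is $1$ if $k=0$ and $0$ otherwise). $p_n(X)=\sum_{c\in X}c^n$ (with multiplicity)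 and $p_\mu(X)=\prod_r p_{\mu_r}(X)$ (product over the parts of $\mu$). $\binom{a}{n}=a(a-1)\cdots(a-n+1)/n!$ for any $a$ (possibly a negative integer) and integer $n\ge0$. *)

theory Defs
  imports "HOL-Computational_Algebra.Computational_Algebra"
begin

section \<open>Partitions\<close>

text \<open>A partition is the weakly decreasing list of its nonzero parts, so \<open>l(\<mu>)\<close> is
  \<open>length \<mu>\<close>, \<open>|\<mu>|\<close> is \<open>sum_list \<mu>\<close> and \<open>m\<^sub>i(\<mu>)\<close> is \<open>count_list \<mu> i\<close>.\<close>

definition is_partition :: "nat list \<Rightarrow> bool" where
  "is_partition \<mu> \<longleftrightarrow> sorted_wrt (\<ge>) \<mu> \<and> 0 \<notin> set \<mu>"

definition partitions_of :: "nat \<Rightarrow> nat list set" where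
  "partitions_of j = {\<mu>. is_partition \<mu> \<and> sum_list \<mu> = j}"

lemma finite_partitions_of: "finite (partitions_of j)"
proof (rule finite_subset)
  have len: "length \<mu> \<le> sum_list \<mu>" if "0 \<notin> set \<mu>" for \<mu> :: "nat list"
    using that by (induction \<mu>) (auto simp: Suc_le_eq)
  show "partitions_of j \<subseteq> {\<mu>. set \<mu> \<subseteq> {..j} \<and> length \<mu> \<le> j}"
    using len by (auto simp: partitions_of_def is_partition_def member_le_sum_list)
  show "finite {\<mu>. set \<mu> \<subseteq> {..j} \<and> length \<mu> \<le> j}"
    by (rule finite_lists_length_le) simp
qed

text \<open>Cells are numbered from 1, list positions from 0.\<close>

definition ferrers :: "nat list \<Rightarrow> (nat \<times> nat) set" where
  "ferrers lam = {(a, b). 1 \<le> a \<and> a \<le> length lam \<and> 1 \<le> b \<and> b \<le> lam ! (a - 1)}"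

definition z_part :: "nat list \<Rightarrow> nat" where
  "z_part \<mu> = (\<Prod>i\<in>set \<mu>. i ^ count_list \<mu> i * fact (count_list \<mu> i))"

text \<open>The generalized binomial coefficient \<open>\<langle>\<mu> over k\<rangle>\<close>.\<close>

definition row_binomial :: "nat list \<Rightarrow> nat \<Rightarrow> nat" where
  "row_binomial \<mu> k =
     card {S. S \<subseteq> ferrers \<mu> \<and> card S = k \<and> (\<forall>a\<in>{1..length \<mu>}. \<exists>b. (a, b) \<in> S)}"

text \<open>\<open>(x)\<^sub>\<lambda>\<close> with parameter \<open>\<alpha>\<close>.\<close>

definition gen_pochhammer :: "'a::field \<Rightarrow> 'a \<Rightarrow> nat list \<Rightarrow> 'a" where
  "gen_pochhammer \<alpha> x lam =
     (\<Prod>(a, b)\<in>ferrers lam. x + of_nat b - 1 - (of_nat a - 1) / \<alpha>)"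

definition content_alphabet :: "'a::field \<Rightarrow> nat list \<Rightarrow> 'a multiset" where
  "content_alphabet \<alpha> lam =
     image_mset (\<lambda>(a, b). of_nat b - 1 - (of_nat a - 1) / \<alpha>) (mset_set (ferrers lam))"

definition power_sum :: "nat \<Rightarrow> 'a::comm_semiring_1 multiset \<Rightarrow> 'a" where
  "power_sum n X = (\<Sum>c\<in>#X. c ^ n)"

definition power_sum_part :: "nat list \<Rightarrow> 'a::comm_semiring_1 multiset \<Rightarrow> 'a" where
  "power_sum_part \<mu> X = (\<Prod>r\<leftarrow>\<mu>. power_sum r X)"


section \<open>Formal power series in \<open>1/y\<close>\<close>

text \<open>For a coefficient field \<open>K\<close>, everything takes place in the field \<open>K(x)((1/y))\<close>: the variable
  of the formal Laurent series is \<open>1/y\<close>, so \<open>y\<close> is \<^const>\<open>fls_X_inv\<close>. Rational functions in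
  \<open>x\<close> and \<open>y\<close> are thereby expanded at \<open>y = \<infinity>\<close>. The topology on Laurent series in the library
  is the \<open>1/y\<close>-adic one.\<close>

type_synonym 'a xy_series = "'a poly fract fls"

definition scalar :: "'a::field \<Rightarrow> 'a xy_series" where
  "scalar c = fls_const (to_fract [:c:])"

definition indet_x :: "'a::field xy_series" where
  "indet_x = fls_const (to_fract [:0, 1:])"

definition indet_y :: "'a::field xy_series" where
  "indet_y = fls_X_inv"

text \<open>The inclusion of \<open>K[x][[1/y]]\<close>.\<close>

definition of_poly_series :: "'a::field poly fps \<Rightarrow> 'a xy_series" where
  "of_poly_series F = fps_to_fls (Abs_fps (\<lambda>n. to_fract (fps_nth F n)))"

end

theory Submission
  imports Defs
begin

text \<open>
  Let \<open>n = |\<lambda>|\<close>, let \<open>c\<close> run through the \<open>n\<close> contents in \<open>X\<close>, and put \<open>w = - x / y\<close> and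
  \<open>v = - 1 / y\<close>. The left-hand side is the product of the factors
  \<open>(y - x + c) / (y + c) = 1 + w / (1 - c v)\<close>. Expanding the product over subsets of cells
  gives \<open>\<Sum>i. w\<^sup>i e\<^sub>i(1 / (1 - c v))\<close>, a sum over \<open>i \<le> n\<close>. The theorem therefore amounts to the
  formula for the coefficient of \<open>v\<^sup>j\<close> in \<open>e\<^sub>i(1 / (1 - c v))\<close> that is proved in
  \<open>partition_sum_eq\<close>.

  That formula holds for an arbitrary finite family \<open>c\<close> and comes from two generating functions. By
  \<open>row_binomial_gf\<close>, the generating function of the generalized binomial coefficients of \<open>\<mu>\<close> is the
  product of \<open>(1 + w)\<^sup>r - 1\<close> over the parts \<open>r\<close> of \<open>\<mu>\<close>. By the exponential formula
  (\<open>cycle_series_power_sums\<close>), summing products over the parts of \<open>\<mu>\<close> with weight \<open>1 / z\<^sub>\<mu>\<close> turns a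
  difference of power sums into a quotient of products of linear factors. Together they identify
  the partition sums with the coefficients of \<open>\<Prod>c. 1 + w / (1 - c v)\<close>.

  The computation of the series takes place in \<open>K[x][[1/y]]\<close>; \<open>sums_of_poly_series\<close> transfers
  convergence from there to the field of Laurent series.
\<close>

section \<open>Geometric series and logarithmic derivatives\<close>

definition geometric :: "'b::comm_ring_1 \<Rightarrow> 'b fps" where
  "geometric c = Abs_fps (\<lambda>n. c ^ n)"

lemma geometric_nth [simp]: "geometric c $ n = c ^ n"
  by (simp add: geometric_def)

lemma geometric_inverse: "(1 - fps_const c * fps_X) * geometric c = 1"
proof (rule fps_ext)
  fix n show "((1 - fps_const c * fps_X) * geometric c) $ n = 1 $ n"
    by (cases n) (simp_all add: algebra_simps)
qed

text \<open>A logarithmic derivative is expressed without division: \<open>X F' = G F\<close> says that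
  \<open>G = X F' / F\<close>. Comparing the coefficients of \<open>X\<^sup>n\<close> expresses \<open>n F\<^sub>n\<close> by \<open>F\<^sub>0, \<dots>, F\<^bsub>n-1\<^esub>\<close>,
  because \<open>G\<^sub>0 = 0\<close>, so that \<open>F\<close> is determined by \<open>G\<close> and the constant coefficient.\<close>

lemma log_deriv_unique:
  fixes F H G :: "'b::{idom,semiring_char_0} fps"
  assumes F: "fps_X * fps_deriv F = G * F" and H: "fps_X * fps_deriv H = G * H"
    and "G $ 0 = 0" and 0: "F $ 0 = H $ 0"
  shows "F = H"
proof (rule fps_ext)
  fix n show "F $ n = H $ n"
  proof (induction n rule: less_induct)
    case (less n)
    have rec: "of_nat n * K $ n = (\<Sum>k=1..n. G $ k * K $ (n - k))"
      if "fps_X * fps_deriv K = G * K" for K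
    proof -
      have "of_nat n * K $ n = (fps_X * fps_deriv K) $ n"
        by (cases n) simp_all
      also have "\<dots> = (\<Sum>k=0..n. G $ k * K $ (n - k))"
        by (simp add: that fps_mult_nth)
      finally show ?thesis
        using \<open>G $ 0 = 0\<close> by (simp add: sum.atLeast_Suc_atMost)
    qed
    show ?case
    proof (cases "n = 0")
      case False
      have "of_nat n * F $ n = of_nat n * H $ n"
        unfolding rec[OF F] rec[OF H] using less by (intro sum.cong) auto
      then show ?thesis using False by simp
    qed (use 0 in simp)
  qed
qed

lemma log_deriv_mult:
  fixes F G :: "'b::comm_ring_1 fps"
  assumes "fps_X * fps_deriv F = G * F" "fps_X * fps_deriv F' = G' * F'"
  shows "fps_X * fps_deriv (F * F') = (G + G') * (F * F')"
proof -
  have "fps_X * fps_deriv (F * F') = F * (fps_X * fps_deriv F') + (fps_X * fps_deriv F) * F'"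
    by (simp add: algebra_simps)
  also have "\<dots> = (G + G') * (F * F')"
    unfolding assms by (simp add: algebra_simps)
  finally show ?thesis .
qed

lemma log_deriv_prod:
  fixes F G :: "'p \<Rightarrow> 'b::comm_ring_1 fps"
  assumes "finite C" and "\<And>p. p \<in> C \<Longrightarrow> fps_X * fps_deriv (F p) = G p * F p"
  shows "fps_X * fps_deriv (\<Prod>p\<in>C. F p) = (\<Sum>p\<in>C. G p) * (\<Prod>p\<in>C. F p)"
  using assms
proof (induction C rule: finite_induct)
  case (insert p C)
  then show ?case
    using log_deriv_mult[of "F p" "G p" "\<Prod>p\<in>C. F p" "\<Sum>p\<in>C. G p"] by simp
qed simp

lemma log_deriv_geometric:
  "fps_X * fps_deriv (geometric c) = (geometric c - 1) * geometric c"
proof (rule fps_ext)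
  fix n
  have "((geometric c - 1) * geometric c) $ n = (\<Sum>k=0..n. c ^ n) - c ^ n"
    by (simp add: left_diff_distrib fps_mult_nth flip: power_add)
  then show "(fps_X * fps_deriv (geometric c)) $ n = ((geometric c - 1) * geometric c) $ n"
    by (cases n) (simp_all add: algebra_simps)
qed

lemma log_deriv_linear:
  "fps_X * fps_deriv (1 - fps_const c * fps_X) = (1 - geometric c) * (1 - fps_const c * fps_X)"
  using geometric_inverse[of c] by (simp add: algebra_simps)

lemma log_deriv_quotient:
  "fps_X * fps_deriv ((1 - fps_const d * fps_X) * geometric c)
     = (geometric c - geometric d) * ((1 - fps_const d * fps_X) * geometric c)"
  using log_deriv_mult[OF log_deriv_linear log_deriv_geometric] by simp

section \<open>The exponential formula over partitions\<close>

text \<open>The lemmas about \<open>insort\<close> and \<open>remove1\<close> concern increasing lists; hence the reversals.\<close>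

definition insert_part :: "nat \<Rightarrow> nat list \<Rightarrow> nat list" where
  "insert_part r \<mu> = rev (insort r (rev \<mu>))"

definition remove_part :: "nat \<Rightarrow> nat list \<Rightarrow> nat list" where
  "remove_part r \<mu> = rev (remove1 r (rev \<mu>))"

lemma is_partition_iff: "is_partition \<mu> \<longleftrightarrow> sorted (rev \<mu>) \<and> 0 \<notin> set \<mu>"
  by (simp add: is_partition_def sorted_wrt_rev)

lemma mset_insert_part [simp]: "mset (insert_part r \<mu>) = add_mset r (mset \<mu>)"
  by (simp add: insert_part_def)

lemma set_insert_part [simp]: "set (insert_part r \<mu>) = insert r (set \<mu>)"
  by (metis mset_insert_part set_mset_add_mset_insert set_mset_mset)

lemma count_list_insert_part:
  "count_list (insert_part r \<mu>) i = count_list \<mu> i + (if i = r then 1 else 0)"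
  by (simp flip: count_mset)

lemma insert_part_partition:
  "r > 0 \<Longrightarrow> \<nu> \<in> partitions_of m \<Longrightarrow> insert_part r \<nu> \<in> partitions_of (m + r)"
  by (simp add: partitions_of_def is_partition_iff)
     (simp add: insert_part_def sorted_insort flip: sum_mset_sum_list)

lemma remove_part_partition:
  assumes "\<mu> \<in> partitions_of m" "r \<in> set \<mu>"
  shows "remove_part r \<mu> \<in> partitions_of (m - r)"
proof -
  have "sum_list (remove_part r \<mu>) = sum_list \<mu> - r"
    using assms(2) sum_list_map_remove1[of r "rev \<mu>" "\<lambda>x. x"] by (simp add: remove_part_def)
  moreover have "0 \<notin> set (remove_part r \<mu>)" if "0 \<notin> set \<mu>"
    using that by (auto simp: remove_part_def dest: notin_set_remove1)
  moreover have "sorted (remove1 r (rev \<mu>))" if "sorted (rev \<mu>)"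
    using that sorted_remove1 by blast
  ultimately show ?thesis
    using assms(1) by (auto simp: partitions_of_def is_partition_iff remove_part_def)
qed

lemma remove_insert_part: "remove_part r (insert_part r \<nu>) = \<nu>"
  by (simp add: remove_part_def insert_part_def)

lemma insert_remove_part:
  assumes "is_partition \<mu>" "r \<in> set \<mu>"
  shows "insert_part r (remove_part r \<mu>) = \<mu>"
  using assms by (simp add: is_partition_iff insort_remove1 remove_part_def insert_part_def)

lemma z_part_superset:
  assumes "finite A" "set \<mu> \<subseteq> A"
  shows "z_part \<mu> = (\<Prod>i\<in>A. i ^ count_list \<mu> i * fact (count_list \<mu> i))"
  unfolding z_part_def using assms by (intro prod.mono_neutral_left) auto

lemma z_part_insert_part:
  "z_part (insert_part r \<nu>) = r * (count_list \<nu> r + 1) * z_part \<nu>"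
proof -
  let ?A = "insert r (set \<nu>)"
  have "z_part (insert_part r \<nu>)
      = (\<Prod>i\<in>?A. (if i = r then r * (count_list \<nu> r + 1) else 1)
            * (i ^ count_list \<nu> i * fact (count_list \<nu> i)))"
    unfolding z_part_def set_insert_part
  proof (intro prod.cong refl)
    fix i
    have "r ^ (k + 1) * fact (k + 1) = r * (k + 1) * (r ^ k * fact k)" for k
      by (simp add: algebra_simps)
    then show "i ^ count_list (insert_part r \<nu>) i * fact (count_list (insert_part r \<nu>) i)
        = (if i = r then r * (count_list \<nu> r + 1) else 1)
            * (i ^ count_list \<nu> i * fact (count_list \<nu> i))"
      by (simp only: count_list_insert_part split: if_split) simp
  qed
  also have "\<dots> = r * (count_list \<nu> r + 1) * z_part \<nu>"
    by (subst z_part_superset[of ?A \<nu>])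
       (simp_all only: prod.distrib prod.delta finite_set finite.insertI insertI1 if_True, auto)
  finally show ?thesis .
qed

text \<open>The generating series of the cycle index polynomials of the symmetric groups, with \<open>g r\<close>
  in place of the \<open>r\<close>-th power sum. The coefficients are themselves power series (in \<open>w\<close>), because
  the generalized binomial coefficients will be recorded by a generating function.\<close>

definition cycle_series :: "(nat \<Rightarrow> 'a::field_char_0 fps) \<Rightarrow> 'a fps fps" where
  "cycle_series g =
     Abs_fps (\<lambda>j. \<Sum>\<mu>\<in>partitions_of j. fps_const (1 / of_nat (z_part \<mu>)) * (\<Prod>r\<leftarrow>\<mu>. g r))"

lemma partitions_of_0: "partitions_of 0 = {[]}"
proof -
  have "\<mu> = []" if "0 \<notin> set \<mu>" "sum_list \<mu> = 0" for \<mu> :: "nat list"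
    using that by (cases \<mu>) auto
  then show ?thesis
    by (auto simp: partitions_of_def is_partition_def)
qed

lemma cycle_series_0: "cycle_series g $ 0 = 1"
  by (simp add: cycle_series_def partitions_of_0 z_part_def)

text \<open>This is \<open>cycle_series g = exp (\<Sum>r. g r X\<^sup>r / r)\<close> in differentiated form. A partition \<open>\<mu>\<close> of \<open>j\<close>
  satisfies \<open>j = \<Sum>r. r m\<^sub>r(\<mu>)\<close> over its distinct parts \<open>r\<close>, and \<open>r m\<^sub>r(\<mu>) / z\<^sub>\<mu> = 1 / z\<^sub>\<nu>\<close> when \<open>\<nu>\<close>
  arises from \<open>\<mu>\<close> by deleting one part \<open>r\<close>; deleting a part is a bijection from pairs
  \<open>(\<mu>, r)\<close> to pairs \<open>(r, \<nu>)\<close> with \<open>\<nu>\<close> a partition of \<open>j - r\<close>.\<close>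

lemma cycle_series_log_deriv:
  fixes g :: "nat \<Rightarrow> 'a::field_char_0 fps"
  assumes "g 0 = 0"
  shows "fps_X * fps_deriv (cycle_series g) = Abs_fps g * cycle_series g"
proof (rule fps_ext)
  fix j
  define f where "f \<mu> = fps_const (1 / of_nat (z_part \<mu>)) * (\<Prod>r\<leftarrow>\<mu>. g r)" for \<mu>
  have f_insert: "of_nat (r * count_list (insert_part r \<nu>) r) * f (insert_part r \<nu>) = g r * f \<nu>"
    if "r > 0" for r \<nu>
  proof -
    define n where "n = r * count_list (insert_part r \<nu>) r"
    have "n \<noteq> 0" and "z_part (insert_part r \<nu>) = n * z_part \<nu>"
      using that by (simp_all add: n_def count_list_insert_part z_part_insert_part)
    then have z: "of_nat n * fps_const (1 / of_nat (z_part (insert_part r \<nu>)))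
        = fps_const (1 / of_nat (z_part \<nu>) :: 'a)"
      by (simp flip: fps_of_nat)
    have "(\<Prod>s\<leftarrow>insert_part r \<nu>. g s) = g r * (\<Prod>s\<leftarrow>\<nu>. g s)"
      by (simp flip: prod_mset_prod_list)
    then have "of_nat n * f (insert_part r \<nu>)
      = (of_nat n * fps_const (1 / of_nat (z_part (insert_part r \<nu>)))) * (g r * (\<Prod>s\<leftarrow>\<nu>. g s))"
      by (simp only: f_def mult.assoc)
    also have "\<dots> = g r * f \<nu>"
      unfolding z f_def by (simp only: mult.left_commute)
    finally show ?thesis
      by (simp only: n_def)
  qed
  have "(fps_X * fps_deriv (cycle_series g)) $ j = of_nat j * (\<Sum>\<mu>\<in>partitions_of j. f \<mu>)"
    by (cases j) (simp_all add: cycle_series_def f_def)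
  also have "\<dots> = (\<Sum>\<mu>\<in>partitions_of j. \<Sum>r\<in>set \<mu>. of_nat (r * count_list \<mu> r) * f \<mu>)"
  proof -
    have "of_nat j = (\<Sum>r\<in>set \<mu>. of_nat (r * count_list \<mu> r) :: 'a fps)" if "\<mu> \<in> partitions_of j" for \<mu>
    proof -
      have "j = (\<Sum>r\<in>set \<mu>. r * count_list \<mu> r)"
        using that sum_list_map_eq_sum_count[of "\<lambda>x. x" \<mu>]
        by (simp add: partitions_of_def mult.commute)
      then show ?thesis by (simp only: of_nat_sum)
    qed
    then show ?thesis
      unfolding sum_distrib_left by (intro sum.cong) (auto simp: sum_distrib_right)
  qed
  also have "\<dots> = (\<Sum>(\<mu>, r)\<in>Sigma (partitions_of j) set. of_nat (r * count_list \<mu> r) * f \<mu>)"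
    by (simp add: sum.Sigma finite_partitions_of)
  also have "\<dots> = (\<Sum>(r, \<nu>)\<in>Sigma {1..j} (\<lambda>r. partitions_of (j - r)). g r * f \<nu>)"
  proof (rule sum.reindex_bij_witness[where j = "\<lambda>(\<mu>, r). (r, remove_part r \<mu>)"
        and i = "\<lambda>(r, \<nu>). (insert_part r \<nu>, r)"]; clarsimp)
    fix \<mu> r assume *: "\<mu> \<in> partitions_of j" "r \<in> set \<mu>"
    then have "r > 0" "is_partition \<mu>" "r \<le> j"
      by (auto simp: partitions_of_def is_partition_def member_le_sum_list intro!: gr0I)
    then show "insert_part r (remove_part r \<mu>) = \<mu>"
      and "Suc 0 \<le> r \<and> r \<le> j \<and> remove_part r \<mu> \<in> partitions_of (j - r)"
      using * remove_part_partition by (auto simp: insert_remove_part)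
    show "g r * f (remove_part r \<mu>) = of_nat r * of_nat (count_list \<mu> r) * f \<mu>"
      using f_insert[of r "remove_part r \<mu>"] \<open>r > 0\<close> \<open>is_partition \<mu>\<close> *(2)
      by (simp add: insert_remove_part)
  next
    fix r \<nu> assume *: "Suc 0 \<le> r" "r \<le> j" "\<nu> \<in> partitions_of (j - r)"
    then show "insert_part r \<nu> \<in> partitions_of j"
      using insert_part_partition[of r \<nu> "j - r"] by simp
  qed (simp_all add: remove_insert_part)
  also have "\<dots> = (\<Sum>r=1..j. g r * cycle_series g $ (j - r))"
    by (simp add: sum.Sigma finite_partitions_of sum_distrib_left cycle_series_def f_def)
  also have "\<dots> = (Abs_fps g * cycle_series g) $ j"
    using assms by (simp add: fps_mult_nth sum.atLeast_Suc_atMost[of 0 j])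
  finally show "(fps_X * fps_deriv (cycle_series g)) $ j = (Abs_fps g * cycle_series g) $ j" .
qed

text \<open>Both sides have the logarithmic derivative \<open>\<Sum>p. 1 / (1 - c\<^sub>p X) - 1 / (1 - d\<^sub>p X)\<close>.\<close>

lemma cycle_series_power_sums:
  fixes c :: "'p \<Rightarrow> 'a::field_char_0 fps"
  assumes "finite C"
  shows "cycle_series (\<lambda>r. \<Sum>p\<in>C. c p ^ r - d p ^ r)
    = (\<Prod>p\<in>C. (1 - fps_const (d p) * fps_X) * geometric (c p))"
proof (rule log_deriv_unique)
  show "fps_X * fps_deriv (\<Prod>p\<in>C. (1 - fps_const (d p) * fps_X) * geometric (c p))
    = Abs_fps (\<lambda>r. \<Sum>p\<in>C. c p ^ r - d p ^ r) * (\<Prod>p\<in>C. (1 - fps_const (d p) * fps_X) * geometric (c p))"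
  proof -
    have "Abs_fps (\<lambda>r. \<Sum>p\<in>C. c p ^ r - d p ^ r) = (\<Sum>p\<in>C. geometric (c p) - geometric (d p))"
      by (rule fps_ext) (simp add: fps_sum_nth)
    then show ?thesis
      using log_deriv_prod[OF assms log_deriv_quotient] by simp
  qed
  have "(\<Prod>p\<in>C. (1 - fps_const (d p) * fps_X) * geometric (c p)) $ 0 = 1"
    using assms by (induction C rule: finite_induct) simp_all
  then show "cycle_series (\<lambda>r. \<Sum>p\<in>C. c p ^ r - d p ^ r) $ 0
    = (\<Prod>p\<in>C. (1 - fps_const (d p) * fps_X) * geometric (c p)) $ 0"
    by (simp add: cycle_series_0)
qed (simp_all add: cycle_series_log_deriv)

section \<open>Generalized binomial coefficients\<close>

lemma ferrers_Sigma: "ferrers \<mu> = Sigma {1..length \<mu>} (\<lambda>a. {1..\<mu> ! (a - 1)})"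
  by (auto simp: ferrers_def)

lemma finite_ferrers: "finite (ferrers \<mu>)"
  by (simp add: ferrers_Sigma)

lemma card_ferrers: "card (ferrers \<mu>) = sum_list \<mu>"
  unfolding ferrers_Sigma
  by (simp add: sum_list_sum_nth sum.atLeast1_atMost_eq atLeast0LessThan)

lemma sum_nonempty_subsets:
  fixes u :: "'b::comm_ring_1"
  assumes "finite B"
  shows "(\<Sum>T\<in>Pow B - {{}}. u ^ card T) = (1 + u) ^ card B - 1"
proof -
  have "(1 + u) ^ card B = (\<Sum>T\<in>Pow B. u ^ card T)"
    using prod_add[OF assms, of "\<lambda>_. u" "\<lambda>_. 1"] by (simp add: add.commute)
  then show ?thesis
    using assms by (simp add: sum_diff1)
qed

text \<open>The rows choose their cells independently: a set of cells that meets every row is a family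
  of nonempty subsets, one of each row, and a row of length \<open>r\<close> contributes
  \<open>(1 + X)\<^sup>r - 1\<close>.\<close>

lemma row_binomial_gf:
  "(\<Prod>r\<leftarrow>\<mu>. (1 + fps_X) ^ r - 1 :: 'b::comm_ring_1 fps) $ k = of_nat (row_binomial \<mu> k)"
proof -
  let ?R = "{1..length \<mu>}"
  define V where "V = {S. S \<subseteq> ferrers \<mu> \<and> (\<forall>a\<in>?R. \<exists>b. (a, b) \<in> S)}"
  define P where "P = PiE ?R (\<lambda>a. Pow {1..\<mu> ! (a - 1)} - {{}})"
  have "finite V"
    unfolding V_def by (rule finite_subset[of _ "Pow (ferrers \<mu>)"]) (auto simp: finite_ferrers)
  have "(\<Prod>r\<leftarrow>\<mu>. (1 + fps_X) ^ r - 1 :: 'b fps) = (\<Prod>a\<in>?R. (1 + fps_X) ^ card {1..\<mu> ! (a - 1)} - 1)"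
    by (simp add: prod.list_conv_set_nth prod.atLeast1_atMost_eq atLeast0LessThan)
  also have "\<dots> = (\<Sum>f\<in>P. \<Prod>a\<in>?R. fps_X ^ card (f a))"
    unfolding P_def by (subst prod_sum_PiE[symmetric]) (simp_all add: sum_nonempty_subsets)
  also have "\<dots> = (\<Sum>S\<in>V. fps_X ^ card S)"
  proof (rule sum.reindex_bij_witness[where j = "\<lambda>f. Sigma ?R f"
        and i = "\<lambda>S. \<lambda>a\<in>?R. {b. (a, b) \<in> S}"])
    fix f assume f: "f \<in> P"
    then have fin: "finite (f a)" if "a \<in> ?R" for a
      using that by (auto simp: P_def PiE_def Pi_def intro: finite_subset)
    show "(\<lambda>a\<in>?R. {b. (a, b) \<in> Sigma ?R f}) = f"
      using f by (auto simp: P_def PiE_def extensional_def fun_eq_iff)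
    show "Sigma ?R f \<in> V"
      using f unfolding V_def P_def ferrers_Sigma by (fastforce simp: PiE_def Pi_def)
    show "fps_X ^ card (Sigma ?R f) = (\<Prod>a\<in>?R. fps_X ^ card (f a) :: 'b fps)"
      using fin by (simp add: power_sum)
  next
    fix S assume S: "S \<in> V"
    then show "Sigma ?R (\<lambda>a\<in>?R. {b. (a, b) \<in> S}) = S"
      by (auto simp: V_def ferrers_Sigma)
    show "(\<lambda>a\<in>?R. {b. (a, b) \<in> S}) \<in> P"
      using S by (auto simp: V_def P_def ferrers_Sigma)
  qed
  also have "\<dots> $ k = (\<Sum>S\<in>V. if card S = k then 1 else 0)"
    by (simp add: fps_sum_nth eq_commute)
  also have "\<dots> = of_nat (card {S \<in> V. card S = k})"
    using \<open>finite V\<close> by (simp add: sum.If_cases Int_def)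
  also have "{S \<in> V. card S = k} = {S. S \<subseteq> ferrers \<mu> \<and> card S = k \<and> (\<forall>a\<in>?R. \<exists>b. (a, b) \<in> S)}"
    by (auto simp: V_def)
  finally show ?thesis
    by (simp add: row_binomial_def)
qed

lemma row_binomial_eq_0:
  assumes "sum_list \<mu> < k"
  shows "row_binomial \<mu> k = 0"
proof -
  have "card S \<noteq> k" if "S \<subseteq> ferrers \<mu>" for S
    using assms card_mono[OF finite_ferrers that] by (simp add: card_ferrers)
  then have "{S. S \<subseteq> ferrers \<mu> \<and> card S = k \<and> (\<forall>a\<in>{1..length \<mu>}. \<exists>b. (a, b) \<in> S)} = {}"
    by blast
  then show ?thesis
    by (simp only: row_binomial_def card.empty)
qed

section \<open>Elementary symmetric functions of geometric series\<close>

text \<open>The coefficients are the complete homogeneous symmetric polynomials, which are homogeneous and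
  have integer coefficients, so they commute with scaling by \<open>s\<close> and with any ring homomorphism.\<close>

lemma geometric_prod_hom:
  fixes h :: "'b::comm_ring_1 \<Rightarrow> 'c::comm_ring_1"
  assumes add: "\<And>a b. h (a + b) = h a + h b" and mult: "\<And>a b. h (a * b) = h a * h b"
    and one: "h 1 = 1"
  shows "(\<Prod>p\<in>S. geometric (s * h (c p))) $ j = s ^ j * h ((\<Prod>p\<in>S. geometric (c p)) $ j)"
proof -
  have zero: "h 0 = 0"
    using add[of 0 0] by simp
  have power: "h (a ^ n) = h a ^ n" for a n
    by (induction n) (simp_all add: one mult)
  have sum: "h (\<Sum>k\<in>K. f k) = (\<Sum>k\<in>K. h (f k))" for f and K :: "nat set"
    by (induction K rule: infinite_finite_induct) (simp_all add: zero add)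
  show ?thesis
  proof (induction S arbitrary: j rule: infinite_finite_induct)
    case (insert p S)
    have "(s * h (c p)) ^ k * (s ^ (j - k) * h ((\<Prod>p\<in>S. geometric (c p)) $ (j - k)))
        = s ^ j * h (c p ^ k * (\<Prod>p\<in>S. geometric (c p)) $ (j - k))" if "k \<le> j" for k
      using that power_add[of s k "j - k"] by (simp add: power_mult_distrib mult power algebra_simps)
    then show ?case
      using insert by (simp add: fps_mult_nth sum sum_distrib_left)
  qed (auto simp: zero one)
qed

text \<open>The elementary symmetric function \<open>e\<^sub>i\<close> of the series \<open>1 / (1 - c\<^sub>p X)\<close>.\<close>

definition geometric_elementary :: "'p set \<Rightarrow> ('p \<Rightarrow> 'b::comm_ring_1) \<Rightarrow> nat \<Rightarrow> 'b fps" where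
  "geometric_elementary C c i = (\<Sum>S | S \<subseteq> C \<and> card S = i. \<Prod>p\<in>S. geometric (c p))"

lemma prod_one_plus_geometric:
  assumes "finite C"
  shows "(\<Prod>p\<in>C. 1 + w * geometric (c p)) = (\<Sum>i=0..card C. w ^ i * geometric_elementary C c i)"
proof -
  have "(\<Prod>p\<in>C. 1 + w * geometric (c p)) = (\<Sum>S\<in>Pow C. w ^ card S * (\<Prod>p\<in>S. geometric (c p)))"
    using prod_add[OF assms, of "\<lambda>p. w * geometric (c p)" "\<lambda>_. 1"]
    by (simp add: add.commute prod.distrib)
  also have "\<dots> = (\<Sum>i=0..card C. \<Sum>S | S \<in> Pow C \<and> card S = i. w ^ card S * (\<Prod>p\<in>S. geometric (c p)))"
    using assms by (intro sum.group[symmetric]) (auto intro: card_mono)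
  also have "\<dots> = (\<Sum>i=0..card C. w ^ i * geometric_elementary C c i)"
    by (simp add: geometric_elementary_def sum_distrib_left)
  finally show ?thesis .
qed

lemma geometric_elementary_hom:
  fixes h :: "'b::comm_ring_1 \<Rightarrow> 'c::comm_ring_1"
  assumes add: "\<And>a b. h (a + b) = h a + h b" and mult: "\<And>a b. h (a * b) = h a * h b"
    and one: "h 1 = 1"
  shows "geometric_elementary C (\<lambda>p. s * h (c p)) i $ j = s ^ j * h (geometric_elementary C c i $ j)"
proof -
  have zero: "h 0 = 0"
    using add[of 0 0] by simp
  have sum: "h (\<Sum>k\<in>K. f k) = (\<Sum>k\<in>K. h (f k))" for f and K :: "'p set set"
    by (induction K rule: infinite_finite_induct) (simp_all add: zero add)
  show ?thesis
    by (simp add: geometric_elementary_def fps_sum_nth sum sum_distrib_left geometric_prod_hom[of h] assms)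
qed

text \<open>The inner coefficient of the double series in closed form. Let \<open>w\<close> mark \<open>i\<close> and \<open>v\<close> mark \<open>j\<close>. The sum
  over \<open>k\<close> is a convolution with \<open>(1 + w)\<^bsup>n - j\<^esup>\<close>. Writing \<open>\<beta> = 1 / (1 + w)\<close>, the power \<open>(1 + w)\<^bsup>-j\<^esup>\<close> is
  distributed over the parts of \<open>\<mu>\<close> and turns each factor \<open>(1 + w)\<^sup>r - 1\<close> into \<open>1 - \<beta>\<^sup>r\<close>. What remains
  under the partition sum is the power sum of the \<open>c\<^sub>p\<close> minus that of the \<open>\<beta> c\<^sub>p\<close>, and its cycle series
  is \<open>\<Prod>p. (1 - \<beta> c\<^sub>p v) / (1 - c\<^sub>p v)\<close>. Multiplication by \<open>(1 + w)\<^sup>n\<close> makes each factor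
  \<open>(1 + w - c\<^sub>p v) / (1 - c\<^sub>p v) = 1 + w / (1 - c\<^sub>p v)\<close>, a polynomial in \<open>w\<close>.\<close>

lemma partition_sum_eq:
  fixes c :: "'p \<Rightarrow> 'a::field_char_0"
  assumes C: "finite C"
  shows "(\<Sum>k=0..i. ((of_nat (card C) - of_nat j) gchoose (i - k)) *
           (\<Sum>\<mu>\<in>partitions_of j. of_nat (row_binomial \<mu> k) / of_nat (z_part \<mu>) *
              (\<Prod>r\<leftarrow>\<mu>. \<Sum>p\<in>C. c p ^ r)))
       = geometric_elementary C c i $ j"
proof -
  define n where "n = card C"
  define \<beta> :: "'a fps" where "\<beta> = inverse (1 + fps_X)"
  have \<beta>: "(1 + fps_X) * \<beta> = 1"
    by (simp add: \<beta>_def inverse_mult_eq_1')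
  (* In the type 'a fps fps the variable w is fps_const fps_X and v is the outer fps_X. *)
  define cc where "cc = (\<lambda>p. fps_const (c p))"
  define g where "g r = (\<Sum>p\<in>C. cc p ^ r - (\<beta> * cc p) ^ r)" for r
  define ps where "ps r = (\<Sum>p\<in>C. c p ^ r)" for r
  define Q where "Q = (\<Sum>\<mu>\<in>partitions_of j. fps_const (1 / of_nat (z_part \<mu>)) *
      (\<Prod>r\<leftarrow>\<mu>. ((1 + fps_X) ^ r - 1) * fps_const (ps r)))"
  have const_sum: "fps_const (\<Sum>p\<in>C. f p) = (\<Sum>p\<in>C. fps_const (f p))" for f :: "'p \<Rightarrow> 'a"
    using C by (induction C rule: finite_induct) (simp_all flip: fps_const_add)
  have g: "g r = \<beta> ^ r * (((1 + fps_X) ^ r - 1) * fps_const (ps r))" for r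
  proof -
    have "g r = (1 - \<beta> ^ r) * fps_const (ps r)"
      by (simp add: g_def ps_def const_sum cc_def power_mult_distrib algebra_simps
          sum_distrib_left sum_subtractf fps_const_power)
    moreover have "\<beta> ^ r * (1 + fps_X) ^ r = 1"
      by (metis \<beta> mult.commute power_mult_distrib power_one)
    ultimately show ?thesis
      by (simp add: algebra_simps)
  qed
  have Qg: "\<beta> ^ j * Q = cycle_series g $ j"
  proof -
    have "(\<Prod>r\<leftarrow>\<mu>. g r) = \<beta> ^ sum_list \<mu> * (\<Prod>r\<leftarrow>\<mu>. ((1 + fps_X) ^ r - 1) * fps_const (ps r))" for \<mu>
      by (induction \<mu>) (simp_all add: g power_add mult_ac)
    then show ?thesis
      by (simp add: cycle_series_def Q_def sum_distrib_left partitions_of_def mult_ac)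
  qed
  have Qk: "Q $ k = (\<Sum>\<mu>\<in>partitions_of j. of_nat (row_binomial \<mu> k) / of_nat (z_part \<mu>) * (\<Prod>r\<leftarrow>\<mu>. ps r))" for k
  proof -
    have "(\<Prod>r\<leftarrow>\<mu>. ((1 + fps_X) ^ r - 1) * fps_const (ps r))
        = (\<Prod>r\<leftarrow>\<mu>. (1 + fps_X) ^ r - 1) * fps_const (\<Prod>r\<leftarrow>\<mu>. ps r)" for \<mu>
      by (induction \<mu>) (simp_all add: mult_ac flip: fps_const_mult)
    then show ?thesis
      by (simp add: Q_def fps_sum_nth row_binomial_gf)
  qed
  have cycle: "cycle_series g = (\<Prod>p\<in>C. (1 - fps_const (\<beta> * cc p) * fps_X) * geometric (cc p))"
    unfolding g_def by (rule cycle_series_power_sums[OF C])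
  have "fps_const ((1 + fps_X) ^ n) * cycle_series g
      = (\<Prod>p\<in>C. fps_const (1 + fps_X) * ((1 - fps_const (\<beta> * cc p) * fps_X) * geometric (cc p)))"
    unfolding cycle by (subst prod.distrib) (simp add: n_def fps_const_power)
  also have "\<dots> = (\<Prod>p\<in>C. 1 + fps_const fps_X * geometric (cc p))"
  proof (rule prod.cong)
    fix p
    have "fps_const (1 + fps_X) * ((1 - fps_const (\<beta> * cc p) * fps_X) * geometric (cc p))
      = (fps_const (1 + fps_X) - fps_const ((1 + fps_X) * \<beta>) * fps_const (cc p) * fps_X) * geometric (cc p)"
      unfolding fps_const_mult[symmetric] right_diff_distrib left_diff_distrib by (simp only: mult_1_left mult_ac)
    also have "\<dots> = fps_const fps_X * geometric (cc p) + (1 - fps_const (cc p) * fps_X) * geometric (cc p)"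
      unfolding \<beta> by (simp add: algebra_simps flip: fps_const_add)
    finally show "fps_const (1 + fps_X) * ((1 - fps_const (\<beta> * cc p) * fps_X) * geometric (cc p))
        = 1 + fps_const fps_X * geometric (cc p)"
      by (simp add: geometric_inverse)
  qed simp
  also have "\<dots> = (\<Sum>m=0..n. fps_const (fps_X ^ m) * geometric_elementary C cc m)"
    by (simp add: prod_one_plus_geometric[OF C] n_def fps_const_power)
  finally have "(1 + fps_X) ^ n * cycle_series g $ j
      = (\<Sum>m=0..n. fps_const (fps_X ^ m) * geometric_elementary C cc m) $ j"
    by (metis fps_mult_left_const_nth)
  also have "\<dots> = (\<Sum>m=0..n. fps_X ^ m * fps_const (geometric_elementary C c m $ j))"
    using geometric_elementary_hom[of fps_const C 1 c _ j] by (simp add: fps_sum_nth cc_def)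
  finally have expansion: "(1 + fps_X) ^ n * cycle_series g $ j
      = (\<Sum>m=0..n. fps_X ^ m * fps_const (geometric_elementary C c m $ j))" .
  (* The expansion has only terms with m <= n; for i > n both sides of the claim are 0. *)
  have vanish: "geometric_elementary C c i = 0" if "i > n"
  proof -
    have "card S \<noteq> i" if "S \<subseteq> C" for S
      using card_mono[OF C that] \<open>i > n\<close> by (simp add: n_def)
    then have "{S. S \<subseteq> C \<and> card S = i} = {}"
      by blast
    then show ?thesis
      by (simp only: geometric_elementary_def sum.empty)
  qed
  have binom: "fps_binomial (of_nat n - of_nat j) = (1 + fps_X) ^ n * \<beta> ^ j"
  proof -
    have "fps_binomial (of_nat n - of_nat j) = fps_binomial (of_nat n) * fps_binomial (- of_nat j :: 'a)"
      by (simp flip: fps_binomial_add_mult)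
    then show ?thesis
      by (simp add: fps_binomial_of_nat fps_binomial_minus_of_nat \<beta>_def fps_inverse_power)
  qed
  have "(\<Sum>k=0..i. ((of_nat n - of_nat j) gchoose (i - k)) * Q $ k)
      = (Q * fps_binomial (of_nat n - of_nat j)) $ i"
    by (simp add: fps_mult_nth mult.commute)
  also have "Q * fps_binomial (of_nat n - of_nat j) = (1 + fps_X) ^ n * cycle_series g $ j"
    by (simp add: binom mult_ac flip: Qg)
  also have "\<dots> $ i = (\<Sum>m=0..n. if m = i then geometric_elementary C c m $ j else 0)"
    unfolding expansion fps_sum_nth by (intro sum.cong) auto
  also have "\<dots> = geometric_elementary C c i $ j"
    using vanish by auto
  finally show ?thesis
    by (simp add: Qk ps_def n_def)
qed

section \<open>Series in the reciprocal of y\<close>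

lemma of_poly_series_0 [simp]: "of_poly_series 0 = 0"
  by (simp add: of_poly_series_def flip: fps_zero_def)

lemma of_poly_series_1 [simp]: "of_poly_series 1 = 1"
proof -
  have "Abs_fps (\<lambda>n. to_fract (fps_nth (1 :: 'a poly fps) n)) = 1"
    by (rule fps_ext) simp
  then show ?thesis by (simp add: of_poly_series_def)
qed

lemma of_poly_series_add: "of_poly_series (F + G) = of_poly_series F + of_poly_series G"
  by (simp add: of_poly_series_def fps_plus_def flip: fps_to_fls_plus)

lemma of_poly_series_diff: "of_poly_series (F - G) = of_poly_series F - of_poly_series G"
  by (simp add: of_poly_series_def fps_minus_def flip: fps_to_fls_minus)

lemma of_poly_series_mult: "of_poly_series (F * G) = of_poly_series F * of_poly_series G"
  by (simp add: of_poly_series_def fps_times_def flip: fls_times_fps_to_fls)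

lemma of_poly_series_power: "of_poly_series (F ^ n) = of_poly_series F ^ n"
  by (induction n) (simp_all add: of_poly_series_mult)

lemma of_poly_series_sum: "of_poly_series (\<Sum>s\<in>S. F s) = (\<Sum>s\<in>S. of_poly_series (F s))"
  by (induction S rule: infinite_finite_induct) (simp_all add: of_poly_series_add)

lemma of_poly_series_prod: "of_poly_series (\<Prod>s\<in>S. F s) = (\<Prod>s\<in>S. of_poly_series (F s))"
  by (induction S rule: infinite_finite_induct) (simp_all add: of_poly_series_mult)

lemma of_poly_series_const: "of_poly_series (fps_const p) = fls_const (to_fract p)"
proof -
  have "Abs_fps (\<lambda>n. to_fract (fps_nth (fps_const p) n)) = fps_const (to_fract p)"
    by (rule fps_ext) simp
  then show ?thesis by (simp add: of_poly_series_def)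
qed

lemma of_poly_series_X: "of_poly_series fps_X = fls_X"
proof -
  have "Abs_fps (\<lambda>n. to_fract (fps_nth (fps_X :: 'a poly fps) n)) = fps_X"
    by (rule fps_ext) (simp add: fps_X_def)
  then show ?thesis by (simp add: of_poly_series_def)
qed

text \<open>The inclusion preserves the order of vanishing, hence is isometric; convergence can thus be
  checked coefficientwise in the power series ring.\<close>

lemma dist_of_poly_series: "dist (of_poly_series F) (of_poly_series G) = dist F G"
proof -
  define h where "h = Abs_fps (\<lambda>n. to_fract (fps_nth (F - G) n))"
  have d: "of_poly_series F - of_poly_series G = fps_to_fls h"
    using of_poly_series_diff[of F G] by (simp only: h_def of_poly_series_def)
  have "h = 0 \<longleftrightarrow> F = G"
    by (auto simp: h_def fps_eq_iff)
  moreover have "subdegree h = subdegree (F - G)"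
  proof (cases "F = G")
    case False
    then show ?thesis
      by (intro subdegreeI) (auto simp: h_def nth_less_subdegree_zero simp del: fps_sub_nth)
  qed (simp add: h_def flip: fps_zero_def)
  ultimately show ?thesis
    using d fps_to_fls_eq_0_iff[of h]
    by (simp add: dist_fls_def dist_fps_def fls_subdegree_fls_to_fps del: fps_to_fls_eq_0_iff)
       (metis eq_iff_diff_eq_0)
qed

lemma sums_of_poly_series:
  "(\<lambda>j. of_poly_series (fps_const (a j) * fps_X ^ (i + j)))
     sums of_poly_series (fps_X ^ i * Abs_fps a)"
proof -
  have "(\<lambda>n. \<Sum>j<n. fps_const (a j) * fps_X ^ (i + j)) \<longlonglongrightarrow> fps_X ^ i * Abs_fps a"
  proof (rule tendsto_fpsI)
    fix k
    have "(\<Sum>j<n. fps_const (a j) * fps_X ^ (i + j)) $ k = (fps_X ^ i * Abs_fps a) $ k" if "n > k" for n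
    proof -
      have "(\<Sum>j<n. fps_const (a j) * fps_X ^ (i + j)) $ k
          = (\<Sum>j<n. if j = k - i then if k < i then 0 else a j else 0)"
        unfolding fps_sum_nth by (intro sum.cong) auto
      also have "\<dots> = (fps_X ^ i * Abs_fps a) $ k"
        using that by (auto simp: fps_X_power_mult_nth)
      finally show ?thesis .
    qed
    then show "\<forall>\<^sub>F n in sequentially. (\<Sum>j<n. fps_const (a j) * fps_X ^ (i + j)) $ k
        = (fps_X ^ i * Abs_fps a) $ k"
      using eventually_gt_at_top[of k] by (rule eventually_mono[rotated])
  qed
  then show ?thesis
    by (simp add: sums_def tendsto_iff dist_of_poly_series flip: of_poly_series_sum)
qed

lemma scalar_eq: "scalar c = of_poly_series (fps_const [:c:])"
  by (simp add: scalar_def of_poly_series_const)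

lemma scalar_0: "scalar 0 = 0" and scalar_1: "scalar 1 = 1"
  by (simp_all add: scalar_def flip: one_pCons)

lemma scalar_add: "scalar (a + b) = scalar a + scalar b"
  by (simp add: scalar_eq flip: of_poly_series_add)

lemma scalar_diff: "scalar (a - b) = scalar a - scalar b"
  by (simp add: scalar_eq flip: of_poly_series_diff)

lemma scalar_mult: "scalar (a * b) = scalar a * scalar b"
  by (simp add: scalar_eq mult.commute flip: of_poly_series_mult)

lemma scalar_of_nat: "scalar (of_nat n) = of_nat n"
  by (induction n) (simp_all add: scalar_0 scalar_1 scalar_add)

lemma scalar_divide:
  assumes "b \<noteq> 0"
  shows "scalar (a / b) = scalar a / scalar b"
proof -
  have "scalar (a / b) * scalar b = scalar a"
    using assms by (simp flip: scalar_mult)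
  moreover have "scalar b \<noteq> 0"
    using assms by (simp add: scalar_def)
  ultimately show ?thesis
    by (simp add: nonzero_eq_divide_eq)
qed

section \<open>The expansion of the ratio of Pochhammer symbols\<close>

theorem mainTheorem4:
  fixes \<alpha> :: "'a::field_char_0" and lam :: "nat list"
  defines "x \<equiv> (indet_x :: 'a xy_series)"
    and "y \<equiv> (indet_y :: 'a xy_series)"
    and "X \<equiv> content_alphabet \<alpha> lam"
  defines "lhs \<equiv> gen_pochhammer (scalar \<alpha>) (y - x) lam / gen_pochhammer (scalar \<alpha>) y lam"
    and "term_ij \<equiv> (\<lambda>i j. (-1) ^ (i + j) * (x ^ i / y ^ (i + j)) *
           scalar (\<Sum>k=0..min i j. ((of_nat (sum_list lam) - of_nat j) gchoose (i - k)) *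
             (\<Sum>\<mu>\<in>partitions_of j.
                of_nat (row_binomial \<mu> k) / of_nat (z_part \<mu>) * power_sum_part \<mu> X)))"
  assumes "\<alpha> \<noteq> 0" and "is_partition lam"
  shows "lhs \<in> range of_poly_series \<and>
         (\<forall>i\<in>{0..sum_list lam}. summable (\<lambda>j. term_ij i j)) \<and>
         lhs = (\<Sum>i=0..sum_list lam. \<Sum>j. term_ij i j)"
proof -
  define C where "C = ferrers lam"
  define c where "c = (\<lambda>(a, b). of_nat b - 1 - (of_nat a - 1) / \<alpha>)"
  define xx :: "'a poly fps" where "xx = fps_const [:0, 1:]"
  (* The sign in v = - 1/y is moved into the contents, so that v becomes the variable 1/y. *)
  define w where "w = - (xx * fps_X)"
  define d where "d p = [:- c p:]" for p
  have C: "finite C" "card C = sum_list lam"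
    by (simp_all add: C_def finite_ferrers card_ferrers)
  have x: "x = of_poly_series xx"
    by (simp add: x_def xx_def indet_x_def of_poly_series_const)
  have inverse_y: "inverse y = of_poly_series fps_X"
    by (simp add: y_def indet_y_def of_poly_series_X fls_inverse_X_inv)
  have "y \<noteq> 0"
    by (simp add: y_def indet_y_def)

  have shift: "gen_pochhammer (scalar \<alpha>) u lam = (\<Prod>p\<in>C. u + scalar (c p))" for u
    unfolding gen_pochhammer_def C_def
    by (intro prod.cong) (auto simp: c_def scalar_diff scalar_divide scalar_of_nat scalar_1 \<open>\<alpha> \<noteq> 0\<close>)
  have factor: "(y - x + scalar (c p)) / (y + scalar (c p)) = of_poly_series (1 + w * geometric (d p))" for p
  proof -
    have "(y + scalar (c p)) * inverse y = of_poly_series (1 + fps_const [:c p:] * fps_X)"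
      using \<open>y \<noteq> 0\<close>
      by (simp add: distrib_right scalar_eq of_poly_series_add of_poly_series_mult flip: inverse_y)
    also have "1 + fps_const [:c p:] * fps_X = 1 - fps_const (d p) * fps_X"
    proof -
      have "[:c p:] = - d p"
        by (simp add: d_def)
      then show ?thesis
        by (simp flip: fps_const_neg)
    qed
    finally have inv: "(y + scalar (c p)) * inverse y = of_poly_series (1 - fps_const (d p) * fps_X)" .
    have unit: "(y + scalar (c p)) * (inverse y * of_poly_series (geometric (d p))) = 1"
      unfolding mult.assoc[symmetric] inv of_poly_series_mult[symmetric]
      by (simp add: geometric_inverse)
    then have "y + scalar (c p) \<noteq> 0"
      by auto
    have "(y - x + scalar (c p)) / (y + scalar (c p)) = 1 - x / (y + scalar (c p))"
      using \<open>y + scalar (c p) \<noteq> 0\<close> by (simp add: field_simps)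
    also have "1 / (y + scalar (c p)) = inverse y * of_poly_series (geometric (d p))"
      using unit \<open>y + scalar (c p) \<noteq> 0\<close> by (simp add: divide_eq_eq mult.commute)
    then have "x / (y + scalar (c p)) = of_poly_series (xx * (fps_X * geometric (d p)))"
      unfolding of_poly_series_mult x[symmetric] inverse_y[symmetric]
      by (metis times_divide_eq_right mult_1_right)
    finally show ?thesis
      by (simp add: w_def mult.assoc of_poly_series_add of_poly_series_diff flip: of_poly_series_1)
  qed
  have lhs: "lhs = of_poly_series (\<Prod>p\<in>C. 1 + w * geometric (d p))"
    by (simp add: lhs_def shift factor of_poly_series_prod flip: prod_dividef)

  define coef where "coef i j = (\<Sum>k=0..min i j. ((of_nat (sum_list lam) - of_nat j) gchoose (i - k)) *
             (\<Sum>\<mu>\<in>partitions_of j.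
                of_nat (row_binomial \<mu> k) / of_nat (z_part \<mu>) * power_sum_part \<mu> X))" for i j
  have coef: "coef i j = geometric_elementary C c i $ j" for i j
  proof -
    have "power_sum_part \<mu> X = (\<Prod>r\<leftarrow>\<mu>. \<Sum>p\<in>C. c p ^ r)" for \<mu>
      by (simp add: power_sum_part_def power_sum_def X_def content_alphabet_def C_def c_def
          sum_unfold_sum_mset image_mset.compositionality comp_def)
    moreover have "row_binomial \<mu> k = 0" if "\<mu> \<in> partitions_of j" "j < k" for \<mu> k
      using that row_binomial_eq_0[of \<mu> k] by (simp add: partitions_of_def)
    ultimately show ?thesis
      unfolding coef_def partition_sum_eq[OF C(1), symmetric] C(2)
      by (intro sum.mono_neutral_cong_left) auto
  qed

  have sums: "term_ij i sums of_poly_series (w ^ i * geometric_elementary C d i)" for i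
  proof -
    define a where "a j = [:0, 1:] ^ i * [:(-1) ^ (i + j) * coef i j:]" for j
    have terms: "term_ij i j = of_poly_series (fps_const (a j) * fps_X ^ (i + j))" for j
    proof -
      have xy: "x ^ i / y ^ (i + j) = of_poly_series (fps_const ([:0, 1:] ^ i) * fps_X ^ (i + j))"
        by (simp add: divide_inverse power_inverse[symmetric] inverse_y x xx_def
            of_poly_series_mult of_poly_series_power flip: fps_const_power)
      have sign: "(-1) ^ (i + j) * scalar (coef i j) = scalar ((-1) ^ (i + j) * coef i j)"
      proof -
        have "scalar ((-1 :: 'a) ^ m) = (-1) ^ m" for m
        proof (induction m)
          case (Suc m)
          then show ?case
            using scalar_diff[of "0 :: 'a" "(-1) ^ m"] by (simp add: scalar_0)
        qed (simp add: scalar_1)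
        then show ?thesis
          by (simp only: scalar_mult)
      qed
      have "term_ij i j = of_poly_series (fps_const ([:0, 1:] ^ i) * fps_X ^ (i + j))
          * scalar ((-1) ^ (i + j) * coef i j)"
        unfolding term_ij_def coef_def[symmetric] xy sign[symmetric] by (simp only: mult_ac)
      moreover have "fps_const (a j) * fps_X ^ (i + j)
          = (fps_const ([:0, 1:] ^ i) * fps_X ^ (i + j)) * fps_const [:(-1) ^ (i + j) * coef i j:]"
        unfolding a_def fps_const_mult[symmetric] by (simp only: mult_ac)
      ultimately show ?thesis
        by (simp only: scalar_eq of_poly_series_mult)
    qed
    have limit: "fps_X ^ i * Abs_fps a = w ^ i * geometric_elementary C d i"
    proof -
      have d: "geometric_elementary C d i $ j = [:(-1) ^ j * coef i j:]" for j
      proof -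
        have "d = (\<lambda>p. (-1) * [:c p:])"
          by (simp add: d_def fun_eq_iff)
        then have "geometric_elementary C d i $ j = (-1) ^ j * [:coef i j:]"
          using geometric_elementary_hom[of "\<lambda>a. [:a:]" C "-1" c i j]
          by (simp add: coef one_pCons mult.commute)
        then show ?thesis
          by (cases "even j") simp_all
      qed
      have "Abs_fps a = (- xx) ^ i * geometric_elementary C d i"
      proof (rule fps_ext)
        fix j
        have "(- xx) ^ i = fps_const ((- [:0, 1:]) ^ i)"
          by (simp add: xx_def flip: fps_const_power)
        then have "((- xx) ^ i * geometric_elementary C d i) $ j = (- [:0, 1:]) ^ i * [:(-1) ^ j * coef i j:]"
          by (simp add: d)
        also have "\<dots> = a j"
        proof -
          have "(- q) ^ i * [:(-1) ^ j * e:] = q ^ i * [:(-1) ^ (i + j) * e:]" for q :: "'a poly" and e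
            by (cases "even i") (simp_all add: power_add)
          then show ?thesis
            unfolding a_def .
        qed
        finally show "Abs_fps a $ j = ((- xx) ^ i * geometric_elementary C d i) $ j"
          by simp
      qed
      moreover have "w ^ i = (- xx) ^ i * fps_X ^ i"
      proof -
        have "w = (- xx) * fps_X"
          by (simp add: w_def)
        then show ?thesis
          by (simp only: power_mult_distrib)
      qed
      ultimately show ?thesis
        by (metis mult.assoc mult.commute)
    qed
    show ?thesis
      using sums_of_poly_series[of a i] unfolding limit terms[symmetric] .
  qed
  have "lhs = (\<Sum>i=0..sum_list lam. of_poly_series (w ^ i * geometric_elementary C d i))"
    by (simp only: lhs prod_one_plus_geometric[OF C(1)] of_poly_series_sum C(2))
  also have "\<dots> = (\<Sum>i=0..sum_list lam. \<Sum>j. term_ij i j)"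
    by (intro sum.cong refl sums_unique sums)
  finally have "lhs = (\<Sum>i=0..sum_list lam. \<Sum>j. term_ij i j)" .
  moreover have "summable (term_ij i)" for i
    using sums by (rule sums_summable)
  moreover have "lhs \<in> range of_poly_series"
    unfolding lhs by (rule rangeI)
  ultimately show ?thesis
    by blast
qed

end
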